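(* Let $X$ be a Banach space over $\mathbb{K}$ ($\mathbb{K}=\mathbb{R}$ or $\mathbb{C}$). If $Y$ is a Banach space such that $Y^*$ has the $w^*$-Kadec-Klee property, then $\mathrm{QNA}(X,Y^* )=w^*\mathrm{QNA}(X,Y^* )$.
   Context: Banach spaces are over $\mathbb{K}=\mathbb{R}$ or $\mathbb{C}$. $B_X$ and $S_X$ are the closed unit ball and unit sphere of $X$, and $X^*$ is its topological dual. The dual $Y^*$ has the $w^*$-Kadec-Klee property if the weak-star topology $\sigma(Y^*,Y)$ and the norm topology coincide on $S_{Y^*}$. For a bounded linear operator $T\colon X\to Y^*$: $T\in\mathrm{QNA}(X,Y^* )$ if the norm closure of $T(B_X)$ intersects the sphere $\{u^*\in Y^*:\|u^*\|=\|T\|\}$; $T\in w^*\mathrm{QNA}(X,Y^* )$ if the $\sigma(Y^*,Y)$-closure of $T(B_X)$ intersects the sphere $\{u^*\in Y^*:\|u^*\|=\|T\|\}$. *)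

theory Defs
  imports "HOL-Analysis.Analysis"
begin

text \<open>
  A Banach space over the scalar field \<open>'k\<close> is a type of class \<^class>\<open>banach\<close> (which fixes the norm,
  its completeness and the underlying real structure) together with a multiplication by scalars
  that extends the real one and for which the norm is homogeneous.  The library has no complex
  Banach spaces; only \<open>'k = real\<close> and \<open>'k = complex\<close> are intended.
\<close>

locale banach_over = vector_space scale
  for scale :: "'k::real_normed_field \<Rightarrow> 'a::banach \<Rightarrow> 'a" +
  assumes norm_scale: "norm (scale a x) = norm a * norm x"
    and scale_of_real: "scale (of_real r) x = r *\<^sub>R x"

lemma banach_over_real: "banach_over ((*\<^sub>R) :: real \<Rightarrow> 'a::banach \<Rightarrow> 'a)"
  by unfold_locales (simp_all add: algebra_simps)

lemma banach_over_complex: "banach_over ((*) :: complex \<Rightarrow> complex \<Rightarrow> complex)"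
  by unfold_locales (simp_all add: algebra_simps norm_mult scaleR_conv_of_real)

text \<open>
  \<open>'y \<Rightarrow>\<^sub>L 'k\<close> consists of the bounded real-linear maps; the topological dual is its subspace of
  \<open>'k\<close>-linear ones.  The norm of \<open>'y \<Rightarrow>\<^sub>L 'k\<close> is the supremum of \<open>norm (f y) / norm y\<close>, so it
  restricts to the dual norm.
\<close>

definition dual :: "('k::real_normed_field \<Rightarrow> 'y::banach \<Rightarrow> 'y) \<Rightarrow> ('y \<Rightarrow>\<^sub>L 'k) set" where
  "dual sY = {f. \<forall>a y. blinfun_apply f (sY a y) = a * blinfun_apply f y}"

lemma dual_real: "dual ((*\<^sub>R) :: real \<Rightarrow> 'y::banach \<Rightarrow> 'y) = UNIV"
  by (auto simp: dual_def blinfun.scaleR_right)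

text \<open>
  For scalar-valued maps the strong operator topology is the topology of pointwise convergence,
  i.e. the coarsest one making all evaluations \<open>f \<mapsto> f y\<close> continuous.
\<close>

definition weak_star ::
    "('k::real_normed_field \<Rightarrow> 'y::banach \<Rightarrow> 'y) \<Rightarrow> ('y \<Rightarrow>\<^sub>L 'k) topology" where
  "weak_star sY = subtopology strong_operator_topology (dual sY)"

definition dual_sphere ::
    "('k::real_normed_field \<Rightarrow> 'y::banach \<Rightarrow> 'y) \<Rightarrow> real \<Rightarrow> ('y \<Rightarrow>\<^sub>L 'k) set" where
  "dual_sphere sY r = {u \<in> dual sY. norm u = r}"

definition dual_wstar_Kadec_Klee ::
    "('k::real_normed_field \<Rightarrow> 'y::banach \<Rightarrow> 'y) \<Rightarrow> bool" where
  "dual_wstar_Kadec_Klee sY \<longleftrightarrow>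
     subtopology (weak_star sY) (dual_sphere sY 1) = top_of_set (dual_sphere sY 1)"

text \<open>The bounded \<open>'k\<close>-linear operators from \<open>X\<close> into the dual of \<open>Y\<close>.\<close>

definition operators_to_dual ::
    "('k::real_normed_field \<Rightarrow> 'x::banach \<Rightarrow> 'x) \<Rightarrow> ('k \<Rightarrow> 'y::banach \<Rightarrow> 'y)
      \<Rightarrow> ('x \<Rightarrow>\<^sub>L ('y \<Rightarrow>\<^sub>L 'k)) set" where
  "operators_to_dual sX sY =
     {T. (\<forall>x. blinfun_apply T x \<in> dual sY) \<and>
         (\<forall>a x y. blinfun_apply (blinfun_apply T (sX a x)) y
                = a * blinfun_apply (blinfun_apply T x) y)}"

definition QNA ::
    "('k::real_normed_field \<Rightarrow> 'x::banach \<Rightarrow> 'x) \<Rightarrow> ('k \<Rightarrow> 'y::banach \<Rightarrow> 'y)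
      \<Rightarrow> ('x \<Rightarrow>\<^sub>L ('y \<Rightarrow>\<^sub>L 'k)) set" where
  "QNA sX sY =
     {T \<in> operators_to_dual sX sY.
        closure (blinfun_apply T ` cball 0 1) \<inter> dual_sphere sY (norm T) \<noteq> {}}"

definition wstar_QNA ::
    "('k::real_normed_field \<Rightarrow> 'x::banach \<Rightarrow> 'x) \<Rightarrow> ('k \<Rightarrow> 'y::banach \<Rightarrow> 'y)
      \<Rightarrow> ('x \<Rightarrow>\<^sub>L ('y \<Rightarrow>\<^sub>L 'k)) set" where
  "wstar_QNA sX sY =
     {T \<in> operators_to_dual sX sY.
        (weak_star sY closure_of (blinfun_apply T ` cball 0 1)) \<inter> dual_sphere sY (norm T) \<noteq> {}}"

end

(* If a net in the ball of radius norm u converges weak-star to u, then its norms converge to norm u,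
   by weak-star lower semicontinuity of the norm.  Normalising puts it on the unit sphere, where the
   Kadec-Klee property turns weak-star convergence into norm convergence.  Applied to nets in T(B_X),
   this makes every weak-star closure point of norm equal to norm T a norm closure point. *)
theory Submission
  imports Defs
begin

text \<open>The strong operator topology is the pullback along \<open>blinfun_apply\<close> of the
  product topology on functions, where limits are taken coordinatewise.\<close>

lemma limitin_strong_operator_topology:
  "limitin strong_operator_topology f l F \<longleftrightarrow>
     (\<forall>x. ((\<lambda>i. blinfun_apply (f i) x) \<longlongrightarrow> blinfun_apply l x) F)"
proof -
  have "limitin strong_operator_topology f l F \<longleftrightarrow>
      ((\<lambda>i. blinfun_apply (f i)) \<longlongrightarrow> blinfun_apply l) F"
    unfolding limitin_def tendsto_def strong_operator_topology_def
    by (auto simp: openin_pullback_topology topspace_pullback_topology)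
  also have "\<dots> \<longleftrightarrow> limitin (product_topology (\<lambda>_. euclidean) UNIV)
      (\<lambda>i. blinfun_apply (f i)) (blinfun_apply l) F"
    by (simp add: euclidean_product_topology)
  also have "\<dots> \<longleftrightarrow> (\<forall>x. ((\<lambda>i. blinfun_apply (f i) x) \<longlongrightarrow> blinfun_apply l x) F)"
    by (simp add: limitin_componentwise)
  finally show ?thesis .
qed

lemma dual_scaleR:
  assumes "f \<in> dual sY"
  shows "c *\<^sub>R f \<in> dual sY"
  using assms by (simp add: dual_def blinfun.scaleR_left)

text \<open>Lower semicontinuity of the operator norm: one vector \<open>x\<close> witnesses
  \<open>a < norm u\<close>, and convergence at that \<open>x\<close> alone carries the strict
  inequality over to \<open>f i\<close>.\<close>

lemma eventually_norm_gt_of_pointwise_tendsto: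
  fixes f :: "'i \<Rightarrow> 'a::real_normed_vector \<Rightarrow>\<^sub>L 'b::real_normed_vector"
  assumes lim: "\<And>x. ((\<lambda>i. blinfun_apply (f i) x) \<longlongrightarrow> blinfun_apply u x) F"
    and a: "a < norm u"
  shows "eventually (\<lambda>i. a < norm (f i)) F"
proof (cases "a < 0")
  case True
  then show ?thesis
    by (intro always_eventually allI) (use norm_ge_zero order_less_le_trans in blast)
next
  case False
  \<comment> \<open>Without such an \<open>x\<close>, the number \<open>a \<ge> 0\<close> would
    bound the operator \<open>u\<close>, giving \<open>norm u \<le> a\<close>.\<close>
  then obtain x where x: "a * norm x < norm (blinfun_apply u x)"
    using a norm_blinfun_bound[of a u] by (meson linorder_not_le)
  have "eventually (\<lambda>i. a * norm x < norm (blinfun_apply (f i) x)) F"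
    using tendsto_norm[OF lim] x by (rule order_tendstoD(1))
  then show ?thesis
  proof eventually_elim
    case (elim i)
    then have "a * norm x < norm (f i) * norm x"
      using norm_blinfun[of "f i" x] by linarith
    then show ?case
      by (rule mult_right_less_imp_less) simp
  qed
qed

lemma Kadec_Klee_tendsto:
  assumes KK: "dual_wstar_Kadec_Klee sY"
    and lim: "limitin (weak_star sY) f u F"
    and le: "eventually (\<lambda>i. norm (f i) \<le> norm u) F"
  shows "(f \<longlongrightarrow> u) F"
proof (cases "u = 0")
  \<comment> \<open>Here \<open>u\<close> cannot be normalised, but the norm bound forces
    \<open>f i = 0\<close> eventually.\<close>
  case True
  with le show ?thesis
    by (auto intro: tendsto_eventually elim: eventually_mono)
next
  case False
  from lim have u: "u \<in> dual sY" and f: "eventually (\<lambda>i. f i \<in> dual sY) F"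
    and pt: "\<And>y. ((\<lambda>i. blinfun_apply (f i) y) \<longlongrightarrow> blinfun_apply u y) F"
    by (auto simp: weak_star_def limitin_subtopology limitin_strong_operator_topology)
  \<comment> \<open>The lower estimate is semicontinuity, the upper one is the hypothesis
    \<open>le\<close>.\<close>
  have norms: "((\<lambda>i. norm (f i)) \<longlongrightarrow> norm u) F"
  proof (rule order_tendstoI)
    show "eventually (\<lambda>i. a < norm (f i)) F" if "a < norm u" for a
      using pt that by (rule eventually_norm_gt_of_pointwise_tendsto)
    show "eventually (\<lambda>i. norm (f i) < a) F" if "norm u < a" for a
      using le by eventually_elim (use that in simp)
  qed
  let ?g = "\<lambda>i. f i /\<^sub>R norm (f i)" and ?v = "u /\<^sub>R norm u"
  \<comment> \<open>Ensures that \<open>?g i\<close> really has norm 1: for \<open>f i = 0\<close>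
    the quotient is 0 and lies off the sphere.\<close>
  have nz: "eventually (\<lambda>i. f i \<noteq> 0) F"
    using order_tendstoD(1)[OF norms, of 0] False by (simp add: eventually_mono)
  have "((\<lambda>i. blinfun_apply (?g i) y) \<longlongrightarrow> blinfun_apply ?v y) F" for y
    unfolding blinfun.scaleR_left using False by (intro tendsto_intros norms pt) simp
  moreover have "eventually (\<lambda>i. ?g i \<in> dual_sphere sY 1) F"
    using f nz by eventually_elim (simp add: dual_sphere_def dual_scaleR)
  moreover have "?v \<in> dual_sphere sY 1"
    using u False by (simp add: dual_sphere_def dual_scaleR)
  ultimately have "limitin (subtopology (weak_star sY) (dual_sphere sY 1)) ?g ?v F"
    by (auto simp: weak_star_def limitin_subtopology limitin_strong_operator_topology
        dual_sphere_def elim: eventually_mono)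
  then have "limitin (top_of_set (dual_sphere sY 1)) ?g ?v F"
    using KK by (simp add: dual_wstar_Kadec_Klee_def)
  then have "(?g \<longlongrightarrow> ?v) F"
    by (simp add: limitin_subtopology)
  \<comment> \<open>Multiplying by the convergent norms undoes the normalisation.\<close>
  with norms have "((\<lambda>i. norm (f i) *\<^sub>R ?g i) \<longlongrightarrow> norm u *\<^sub>R ?v) F"
    by (rule tendsto_scaleR)
  moreover have "eventually (\<lambda>i. norm (f i) *\<^sub>R ?g i = f i) F"
    using nz by eventually_elim simp
  ultimately show ?thesis
    using False by (simp add: tendsto_cong)
qed

text \<open>A filter plays the role of a net: the neighbourhoods of \<open>a\<close> are traced on
  \<open>S\<close>, and the trace is proper exactly because every neighbourhood of \<open>a\<close>
  meets \<open>S\<close>.\<close>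

lemma closure_of_imp_limitin:
  assumes "a \<in> X closure_of S"
  obtains F where "F \<noteq> bot" "limitin X (\<lambda>x. x) a F" "eventually (\<lambda>x. x \<in> S) F"
proof
  let ?F = "inf (nhdsin X a) (principal S)"
  have a: "a \<in> topspace X"
    using assms by (simp add: in_closure_of)
  show "?F \<noteq> bot"
    using assms unfolding trivial_limit_def eventually_inf_principal eventually_nhdsin
    by (auto simp: in_closure_of)
  show "limitin X (\<lambda>x. x) a ?F"
    using a by (auto simp: limitin_def eventually_inf_principal eventually_nhdsin)
  show "eventually (\<lambda>x. x \<in> S) ?F"
    by (simp add: eventually_inf_principal)
qed

lemma closure_Int_dual_subset_weak_star_closure_of:
  assumes "S \<subseteq> dual sY"
  shows "closure S \<inter> dual sY \<subseteq> weak_star sY closure_of S"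
proof -
  \<comment> \<open>The identity is continuous from the norm topology to the coarser strong operator
    topology, and continuous maps send closures into closures.\<close>
  have "closure S \<subseteq> strong_operator_topology closure_of S"
    using continuous_map_image_closure_subset[OF strong_operator_topology_weaker_than_euclidean, of S]
    by simp
  then show ?thesis
    using assms by (auto simp: weak_star_def closure_of_subtopology Int_absorb1)
qed

text \<open>The scalar type is left generic, so that the real and the complex case are both
  instances.\<close>

theorem QNA_eq_wstar_QNA:
  assumes KK: "dual_wstar_Kadec_Klee sY"
  shows "QNA sX sY = wstar_QNA sX sY"
proof (intro equalityI subsetI)
  fix T assume T: "T \<in> QNA sX sY"
  then have "blinfun_apply T ` cball 0 1 \<subseteq> dual sY"
    by (auto simp: QNA_def operators_to_dual_def)
  from closure_Int_dual_subset_weak_star_closure_of[OF this] T show "T \<in> wstar_QNA sX sY"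
    by (auto simp: QNA_def wstar_QNA_def dual_sphere_def)
next
  fix T assume T: "T \<in> wstar_QNA sX sY"
  let ?S = "blinfun_apply T ` cball 0 1"
  obtain u where u: "u \<in> weak_star sY closure_of ?S" "u \<in> dual_sphere sY (norm T)"
    using T by (auto simp: wstar_QNA_def)
  obtain F where F: "F \<noteq> bot" "limitin (weak_star sY) (\<lambda>x. x) u F" "eventually (\<lambda>x. x \<in> ?S) F"
    using u(1) by (rule closure_of_imp_limitin)
  \<comment> \<open>Since \<open>norm u = norm T\<close>, the image of the unit ball lies in the
    ball of radius \<open>norm u\<close>, as \<open>Kadec_Klee_tendsto\<close> requires.\<close>
  have "norm w \<le> norm u" if "w \<in> ?S" for w
  proof -
    from that obtain x where x: "norm x \<le> 1" "w = blinfun_apply T x"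
      by auto
    have "norm w \<le> norm T * norm x"
      using x norm_blinfun by blast
    also have "\<dots> \<le> norm T"
      using x by (simp add: mult_left_le)
    finally show ?thesis
      using u(2) by (simp add: dual_sphere_def)
  qed
  then have "eventually (\<lambda>w. norm w \<le> norm u) F"
    using F(3) by (auto elim: eventually_mono)
  with KK F(2) have "((\<lambda>x. x) \<longlongrightarrow> u) F"
    by (rule Kadec_Klee_tendsto)
  moreover have "eventually (\<lambda>x. x \<in> closure ?S) F"
    using F(3) by (rule eventually_mono) (rule closure_subset[THEN subsetD])
  ultimately have "u \<in> closure ?S"
    using F(1) closed_closure by (intro Lim_in_closed_set[of "closure ?S" "\<lambda>x. x" F])
  then show "T \<in> QNA sX sY"
    using T u(2) by (auto simp: QNA_def wstar_QNA_def)
qed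

theorem proposition4p7:
  "(dual_wstar_Kadec_Klee ((*\<^sub>R) :: real \<Rightarrow> 'y::banach \<Rightarrow> 'y) \<longrightarrow>
      QNA ((*\<^sub>R) :: real \<Rightarrow> 'x::banach \<Rightarrow> 'x) ((*\<^sub>R) :: real \<Rightarrow> 'y \<Rightarrow> 'y)
        = wstar_QNA (*\<^sub>R) (*\<^sub>R)) \<and>
   (\<forall>(sX :: complex \<Rightarrow> 'x \<Rightarrow> 'x) (sY :: complex \<Rightarrow> 'y \<Rightarrow> 'y).
      banach_over sX \<longrightarrow> banach_over sY \<longrightarrow> dual_wstar_Kadec_Klee sY \<longrightarrow>
      QNA sX sY = wstar_QNA sX sY)"
proof (intro conjI impI allI)
  assume "dual_wstar_Kadec_Klee ((*\<^sub>R) :: real \<Rightarrow> 'y \<Rightarrow> 'y)"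
  then show "QNA ((*\<^sub>R) :: real \<Rightarrow> 'x \<Rightarrow> 'x) ((*\<^sub>R) :: real \<Rightarrow> 'y \<Rightarrow> 'y) = wstar_QNA (*\<^sub>R) (*\<^sub>R)"
    by (rule QNA_eq_wstar_QNA)
next
  fix sX :: "complex \<Rightarrow> 'x \<Rightarrow> 'x" and sY :: "complex \<Rightarrow> 'y \<Rightarrow> 'y"
  assume "dual_wstar_Kadec_Klee sY"
  then show "QNA sX sY = wstar_QNA sX sY"
    by (rule QNA_eq_wstar_QNA)
qed

end
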